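(* Let $G$ be a finite group, let $P(g)=\frac{r(g)}{|G|}$ for $g\in G$, where $r(g)=|\{h\in G : h^2=g\}|$, let $P^{(n)}$ be the $n$-fold convolution of $P$, and let $U(g)=\frac{1}{|G|}$ be the uniform probability on $G$. Let $G_1=\langle g^2 : g\in G\rangle$ be the subgroup generated by all squares, and let $G'$ be the commutator subgroup of $G$. The following conditions are equivalent: a) $P^{(n)}$ does not converge to $U$ on $G$ as $n\to\infty$; b) $R_1(G)\neq\varnothing$, i.e. the minimum degree $d$ of the characters in $R(G)$ is $d=1$; c) $G\neq G_1$; d) the order of the group $G/G'$ is even.
   Context: The convolution of two functions $P,Q$ on $G$ is $(P*Q)(h)=\sum_{g\in G}P(g)Q(g^{-1}h)$, $h\in G$, and $P^{(n)}=P*\cdots*P$ ($n$ factors). Convergence is with respect to the norm induced by the scalar product $(F_1,F_2)=\frac{1}{|G|}\sum_{g\in G}F_1(g)\overline{F_2(g)}$ on complex functions on $G$ (equivalently, pointwise). $R(G)$ is the set of all real-valued non-principal irreducible complex characters of $G$, and $R_1(G)$ is the set of linear (degree one) characters in $R(G)$. The principal character is the constant function $\mathbf{1}_G$. In b), the condition "$d=1$" is understood to include that $R(G)$ is nonempty. *)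

theory Defs
  imports
    Complex_Main
    "HOL-Algebra.Generated_Groups"
    "HOL-Algebra.Coset"
    "Jordan_Normal_Form.VS_Connect"
begin

section \<open>Functions on a finite group\<close>

text \<open>Functions on the group are total functions on the ambient type; their values outside the
  carrier are never used. They are complex-valued throughout, so that the scalar product applies.\<close>

definition convolution ::
  "('a, 'b) monoid_scheme \<Rightarrow> ('a \<Rightarrow> complex) \<Rightarrow> ('a \<Rightarrow> complex) \<Rightarrow> 'a \<Rightarrow> complex" where
  "convolution G P Q = (\<lambda>h. \<Sum>g\<in>carrier G. P g * Q (inv\<^bsub>G\<^esub> g \<otimes>\<^bsub>G\<^esub> h))"

text \<open>The empty convolution product is the unit for convolution, the point mass at the
  neutral element; so the first convolution power of \<open>P\<close> is \<open>P\<close> on the carrier.\<close>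

primrec conv_power ::
  "('a, 'b) monoid_scheme \<Rightarrow> ('a \<Rightarrow> complex) \<Rightarrow> nat \<Rightarrow> 'a \<Rightarrow> complex" where
  "conv_power G P 0 = (\<lambda>h. if h = \<one>\<^bsub>G\<^esub> then 1 else 0)"
| "conv_power G P (Suc n) = convolution G P (conv_power G P n)"

definition scalar_product ::
  "('a, 'b) monoid_scheme \<Rightarrow> ('a \<Rightarrow> complex) \<Rightarrow> ('a \<Rightarrow> complex) \<Rightarrow> complex" where
  "scalar_product G F\<^sub>1 F\<^sub>2 =
     1 / of_nat (Coset.order G) * (\<Sum>g\<in>carrier G. F\<^sub>1 g * cnj (F\<^sub>2 g))"

definition group_norm :: "('a, 'b) monoid_scheme \<Rightarrow> ('a \<Rightarrow> complex) \<Rightarrow> real" where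
  "group_norm G F = sqrt (Re (scalar_product G F F))"

definition converges_on ::
  "('a, 'b) monoid_scheme \<Rightarrow> (nat \<Rightarrow> 'a \<Rightarrow> complex) \<Rightarrow> ('a \<Rightarrow> complex) \<Rightarrow> bool" where
  "converges_on G F L \<longleftrightarrow> (\<lambda>n. group_norm G (\<lambda>g. F n g - L g)) \<longlonglongrightarrow> 0"

definition sqrt_count :: "('a, 'b) monoid_scheme \<Rightarrow> 'a \<Rightarrow> nat" where
  "sqrt_count G g = card {h \<in> carrier G. h \<otimes>\<^bsub>G\<^esub> h = g}"

definition sqrt_prob :: "('a, 'b) monoid_scheme \<Rightarrow> 'a \<Rightarrow> complex" where
  "sqrt_prob G g = of_nat (sqrt_count G g) / of_nat (Coset.order G)"

definition uniform_prob :: "('a, 'b) monoid_scheme \<Rightarrow> 'a \<Rightarrow> complex" where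
  "uniform_prob G g = 1 / of_nat (Coset.order G)"

definition squares_subgroup :: "('a, 'b) monoid_scheme \<Rightarrow> 'a set" where
  "squares_subgroup G = generate G {g \<otimes>\<^bsub>G\<^esub> g | g. g \<in> carrier G}"

section \<open>Irreducible complex characters\<close>

text \<open>The target group below is \<open>GL\<^sub>n\<close> over the complex numbers.\<close>

definition is_rep :: "('a, 'b) monoid_scheme \<Rightarrow> nat \<Rightarrow> ('a \<Rightarrow> complex mat) \<Rightarrow> bool" where
  "is_rep G n \<rho> \<longleftrightarrow> \<rho> \<in> hom G (units_of (ring_mat TYPE(complex) n ()))"

text \<open>The zero-dimensional representation does not count as irreducible.\<close>

definition is_irreducible_rep ::
  "('a, 'b) monoid_scheme \<Rightarrow> nat \<Rightarrow> ('a \<Rightarrow> complex mat) \<Rightarrow> bool" where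
  "is_irreducible_rep G n \<rho> \<longleftrightarrow> is_rep G n \<rho> \<and> n > 0 \<and>
     (\<forall>W. VectorSpace.subspace class_ring W (module_vec TYPE(complex) n) \<and>
          (\<forall>g\<in>carrier G. \<forall>w\<in>W. \<rho> g *\<^sub>v w \<in> W)
        \<longrightarrow> W = {0\<^sub>v n} \<or> W = carrier_vec n)"

definition mat_trace :: "complex mat \<Rightarrow> complex" where
  "mat_trace A = (\<Sum>i<dim_row A. A $$ (i, i))"

text \<open>Characters are restricted to the carrier, so that equality of characters is equality
  of functions on the group.\<close>

definition rep_character :: "('a, 'b) monoid_scheme \<Rightarrow> ('a \<Rightarrow> complex mat) \<Rightarrow> 'a \<Rightarrow> complex" where
  "rep_character G \<rho> = (\<lambda>g\<in>carrier G. mat_trace (\<rho> g))"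

definition irr_characters :: "('a, 'b) monoid_scheme \<Rightarrow> ('a \<Rightarrow> complex) set" where
  "irr_characters G = {rep_character G \<rho> | n \<rho>. is_irreducible_rep G n \<rho>}"

definition char_degree :: "('a, 'b) monoid_scheme \<Rightarrow> ('a \<Rightarrow> complex) \<Rightarrow> nat" where
  "char_degree G \<chi> = (THE n. \<exists>\<rho>. is_rep G n \<rho> \<and> \<chi> = rep_character G \<rho>)"

definition principal_character :: "('a, 'b) monoid_scheme \<Rightarrow> 'a \<Rightarrow> complex" where
  "principal_character G = (\<lambda>g\<in>carrier G. 1)"

definition real_irr_characters :: "('a, 'b) monoid_scheme \<Rightarrow> ('a \<Rightarrow> complex) set" where
  "real_irr_characters G =
     {\<chi> \<in> irr_characters G. (\<forall>g\<in>carrier G. \<chi> g \<in> \<real>) \<and> \<chi> \<noteq> principal_character G}"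

definition real_linear_characters :: "('a, 'b) monoid_scheme \<Rightarrow> ('a \<Rightarrow> complex) set" where
  "real_linear_characters G = {\<chi> \<in> real_irr_characters G. char_degree G \<chi> = 1}"

definition min_real_degree :: "('a, 'b) monoid_scheme \<Rightarrow> nat" where
  "min_real_degree G = (LEAST n. n \<in> char_degree G ` real_irr_characters G)"

text \<open>The degree is well defined: it is the value of the character at the neutral element.\<close>

lemma rep_one:
  assumes "group G" "is_rep G n \<rho>"
  shows "\<rho> \<one>\<^bsub>G\<^esub> = 1\<^sub>m n"
proof -
  interpret M: ring "ring_mat TYPE(complex) n ()" by (rule ring_mat)
  interpret group_hom G "units_of (ring_mat TYPE(complex) n ())" \<rho>
    using assms M.units_group by (simp add: group_hom_def group_hom_axioms_def is_rep_def)
  show ?thesis using hom_one by (simp add: units_of_def ring_mat_def)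
qed

lemma rep_character_one:
  assumes "group G" "is_rep G n \<rho>"
  shows "rep_character G \<rho> \<one>\<^bsub>G\<^esub> = of_nat n"
  using assms by (simp add: rep_character_def rep_one mat_trace_def group.is_monoid)

lemma char_degree_rep_character:
  assumes "group G" "is_rep G n \<rho>"
  shows "char_degree G (rep_character G \<rho>) = n"
  unfolding char_degree_def
proof (rule the_equality)
  show "m = n" if "\<exists>\<rho>'. is_rep G m \<rho>' \<and> rep_character G \<rho> = rep_character G \<rho>'" for m
    using that rep_character_one[OF assms(1)] assms(2) by (metis of_nat_eq_iff)
qed (use assms in blast)

end

theory Submission
  imports Defs "HOL-Algebra.Sylow" "HOL-Algebra.Multiplicative_Group"
begin

text \<open>The random walk with step distribution \<open>P\<close> is lazy because \<open>1\<close> is a square. If the squares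
  generate \<open>G\<close>, some power of \<open>P\<close> is bounded below by a positive constant, so by Doeblin's argument
  the distance to the uniform distribution decays geometrically; otherwise the walk never leaves
  the proper subgroup \<open>G\<^sub>1\<close>. A nontrivial real linear character has values \<open>\<plusminus>1\<close> and so its kernel is a proper
  subgroup containing all squares; conversely a maximal proper subgroup containing all squares has
  index two and yields such a character. Finally \<open>G/G'\<close> has odd order iff squaring is a bijection
  of it, and \<open>G' \<le> G\<^sub>1\<close>.\<close>

section \<open>The subgroup generated by the squares\<close>

context group
begin

lemma inv_cancel_left:
  assumes "x \<in> carrier G" "y \<in> carrier G"
  shows "inv x \<otimes> (x \<otimes> y) = y" "x \<otimes> (inv x \<otimes> y) = y"
  using assms by (simp_all flip: m_assoc)

lemma squares_subgroup_is_subgroup: "subgroup (squares_subgroup G) G"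
  unfolding squares_subgroup_def by (rule generate_is_subgroup) auto

lemma square_in_squares_subgroup: "g \<in> carrier G \<Longrightarrow> g \<otimes> g \<in> squares_subgroup G"
  unfolding squares_subgroup_def by (auto intro: generate.incl)

lemma squares_subgroup_subset: "squares_subgroup G \<subseteq> carrier G"
  using squares_subgroup_is_subgroup by (rule subgroup.subset)

lemma squares_subgroup_minimal:
  assumes "subgroup H G" "\<And>g. g \<in> carrier G \<Longrightarrow> g \<otimes> g \<in> H"
  shows "squares_subgroup G \<subseteq> H"
  unfolding squares_subgroup_def by (rule generate_subgroup_incl) (use assms in auto)

text \<open>A group of exponent two is abelian. This is the explicit form of that fact: the inner
  factors cancel, so a commutator is a product of three squares, which gives \<open>G'\<close> \<le>
  \<open>G_1\<close>.\<close>

lemma commutator_eq_squares: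
  assumes "x \<in> carrier G" "y \<in> carrier G"
  shows "x \<otimes> y \<otimes> inv x \<otimes> inv y = (x \<otimes> x) \<otimes> ((inv x \<otimes> y) \<otimes> (inv x \<otimes> y)) \<otimes> (inv y \<otimes> inv y)"
proof -
  have "(x \<otimes> x) \<otimes> ((inv x \<otimes> y) \<otimes> (inv x \<otimes> y)) \<otimes> (inv y \<otimes> inv y)
      = x \<otimes> ((x \<otimes> inv x) \<otimes> (y \<otimes> (inv x \<otimes> ((y \<otimes> inv y) \<otimes> inv y))))"
    using assms by (simp only: m_assoc m_closed inv_closed)
  also have "\<dots> = x \<otimes> y \<otimes> inv x \<otimes> inv y"
    using assms by (simp add: m_assoc)
  finally show ?thesis ..
qed

lemma derived_subset_squares_subgroup: "derived G (carrier G) \<subseteq> squares_subgroup G"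
  unfolding derived_def
proof (rule generate_subgroup_incl[OF _ squares_subgroup_is_subgroup], clarify)
  fix x y assume xy: "x \<in> carrier G" "y \<in> carrier G"
  then have "inv x \<otimes> y \<in> carrier G" "inv y \<in> carrier G" by auto
  with xy show "x \<otimes> y \<otimes> inv x \<otimes> inv y \<in> squares_subgroup G"
    unfolding commutator_eq_squares[OF xy]
    by (intro subgroup.m_closed[OF squares_subgroup_is_subgroup] square_in_squares_subgroup)
qed

subsection \<open>A maximal proper subgroup containing all squares\<close>

text \<open>Squares in \<open>H\<close> make the union of \<open>H\<close> and a single coset of
  \<open>x\<close> a subgroup. It contains \<open>x\<close>, so maximality makes it all of
  \<open>G\<close>, and then \<open>y\<close> must lie in the coset.\<close>

lemma maximal_subgroup_of_squares_index_two:
  assumes H: "subgroup H G" and sq: "\<And>g. g \<in> carrier G \<Longrightarrow> g \<otimes> g \<in> H"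
    and max: "\<And>K. subgroup K G \<Longrightarrow> H \<subseteq> K \<Longrightarrow> K = H \<or> K = carrier G"
    and x: "x \<in> carrier G" "x \<notin> H" and y: "y \<in> carrier G" "y \<notin> H"
  shows "x \<otimes> y \<in> H"
proof -
  interpret H: subgroup H G by (rule H)
  have Hc: "h \<in> carrier G" if "h \<in> H" for h using that by (rule H.mem_carrier)
  \<comment> \<open>Replaces normality of \<open>H\<close>: ba = b^2 (ab)^-1 a^2.\<close>
  have swap: "b \<otimes> a \<in> H" if ab: "a \<in> carrier G" "b \<in> carrier G" "a \<otimes> b \<in> H" for a b
  proof -
    have "(b \<otimes> b) \<otimes> ((inv b \<otimes> inv a) \<otimes> (a \<otimes> a)) \<in> H"
    proof -
      have "inv b \<otimes> inv a = inv (a \<otimes> b)" using ab by (simp add: inv_mult_group)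
      with ab show ?thesis by (simp add: sq)
    qed
    also have "(b \<otimes> b) \<otimes> ((inv b \<otimes> inv a) \<otimes> (a \<otimes> a))
        = b \<otimes> ((b \<otimes> inv b) \<otimes> ((inv a \<otimes> a) \<otimes> a))"
      using ab by (simp only: m_assoc m_closed inv_closed)
    also have "\<dots> = b \<otimes> a" using ab by simp
    finally show ?thesis .
  qed
  \<comment> \<open>The union of \<open>H\<close> and the coset of \<open>inv x\<close>; it contains
    \<open>x\<close> because x^2 lies in \<open>H\<close>.\<close>
  define K where "K = {g \<in> carrier G. g \<in> H \<or> x \<otimes> g \<in> H}"
  have "subgroup K G"
  proof (rule subgroupI)
    show "K \<subseteq> carrier G" by (auto simp: K_def)
    show "K \<noteq> {}" using H.one_closed by (auto simp: K_def)
  next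
    fix g assume "g \<in> K"
    then have g: "g \<in> carrier G" "g \<in> H \<or> x \<otimes> g \<in> H" by (auto simp: K_def)
    show "inv g \<in> K"
    proof (cases "g \<in> H")
      case True then show ?thesis by (auto simp: K_def)
    next
      case False
      \<comment> \<open>Multiplying by the square of \<open>inv g\<close> turns xg into x
        g^-1.\<close>
      have "(x \<otimes> g) \<otimes> (inv g \<otimes> inv g) \<in> H" using g False by (simp add: sq)
      also have "(x \<otimes> g) \<otimes> (inv g \<otimes> inv g) = x \<otimes> ((g \<otimes> inv g) \<otimes> inv g)"
        using g x by (simp only: m_assoc m_closed inv_closed)
      also have "\<dots> = x \<otimes> inv g" using g x by simp
      finally show ?thesis using g by (simp add: K_def)
    qed
  next
    fix g k assume "g \<in> K" "k \<in> K"
    then have g: "g \<in> carrier G" "g \<in> H \<or> x \<otimes> g \<in> H"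
      and k: "k \<in> carrier G" "k \<in> H \<or> x \<otimes> k \<in> H" by (auto simp: K_def)
    consider "g \<in> H" "k \<in> H" | "g \<in> H" "x \<otimes> k \<in> H" | "x \<otimes> g \<in> H" "k \<in> H"
      | "x \<otimes> g \<in> H" "x \<otimes> k \<in> H" using g k by blast
    then have "g \<otimes> k \<in> H \<or> x \<otimes> (g \<otimes> k) \<in> H"
    proof cases
      case 1 then show ?thesis by auto
    next
      case 2
      \<comment> \<open>\<open>swap\<close> moves \<open>x\<close> to the right so that
        \<open>g\<close> can be multiplied on the left, then moves it back.\<close>
      have "g \<otimes> (k \<otimes> x) \<in> H" using 2 swap[of x k] x k by auto
      then have "(g \<otimes> k) \<otimes> x \<in> H" using g k x by (simp add: m_assoc)
      then show ?thesis using swap[of "g \<otimes> k" x] g k x by auto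
    next
      case 3
      have "(x \<otimes> g) \<otimes> k \<in> H" using 3 by auto
      then show ?thesis using g k x by (simp add: m_assoc)
    next
      case 4
      have "inv (x \<otimes> g) \<in> H" using 4 by auto
      \<comment> \<open>Here gk = g^2 (xg)^-1 (xk), a product of three elements of
        \<open>H\<close>.\<close>
      then have "(g \<otimes> g) \<otimes> (inv g \<otimes> inv x) \<otimes> (x \<otimes> k) \<in> H"
        using 4 g x by (simp add: inv_mult_group sq)
      also have "(g \<otimes> g) \<otimes> (inv g \<otimes> inv x) \<otimes> (x \<otimes> k)
          = g \<otimes> ((g \<otimes> inv g) \<otimes> ((inv x \<otimes> x) \<otimes> k))"
        using g x k by (simp only: m_assoc m_closed inv_closed)
      also have "\<dots> = g \<otimes> k" using g x k by simp
      finally show ?thesis ..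
    qed
    then show "g \<otimes> k \<in> K" using g k by (simp add: K_def)
  qed
  moreover have "H \<subseteq> K" using Hc by (auto simp: K_def)
  moreover have "x \<in> K" using x sq by (auto simp: K_def)
  ultimately have "K = carrier G" using max x by blast
  then show ?thesis using y by (auto simp: K_def)
qed

text \<open>By \<open>prod\<close>, \<open>H\<close> has index at most two. The conclusion is
  multiplicativity of the sign that is 1 on \<open>H\<close> and -1 off it, stated without
  numbers.\<close>

lemma index_two_sign_multiplicative:
  assumes H: "subgroup H G"
    and prod: "\<And>x y. \<lbrakk>x \<in> carrier G; x \<notin> H; y \<in> carrier G; y \<notin> H\<rbrakk> \<Longrightarrow> x \<otimes> y \<in> H"
    and xy: "x \<in> carrier G" "y \<in> carrier G"
  shows "x \<otimes> y \<in> H \<longleftrightarrow> (x \<in> H \<longleftrightarrow> y \<in> H)"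
proof -
  interpret H: subgroup H G by (rule H)
  have "y \<in> H" if "x \<in> H" "x \<otimes> y \<in> H"
  proof -
    have "inv x \<otimes> (x \<otimes> y) \<in> H" using that by auto
    then show ?thesis using xy by (simp flip: m_assoc)
  qed
  moreover have "x \<in> H" if "y \<in> H" "x \<otimes> y \<in> H"
  proof -
    have "(x \<otimes> y) \<otimes> inv y \<in> H" using that by auto
    then show ?thesis using xy by (simp add: m_assoc)
  qed
  ultimately show ?thesis using prod[of x y] xy by auto
qed

text \<open>Finiteness provides a maximal proper subgroup above \<open>G_1\<close>; its sign
  function is the desired homomorphism, nontrivial because the subgroup is proper.\<close>

lemma exists_nontrivial_sign_hom:
  assumes fin: "finite (carrier G)" and ne: "carrier G \<noteq> squares_subgroup G"
  obtains \<chi> :: "'a \<Rightarrow> complex" where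
    "\<And>g. g \<in> carrier G \<Longrightarrow> \<chi> g = 1 \<or> \<chi> g = -1"
    "\<And>g h. g \<in> carrier G \<Longrightarrow> h \<in> carrier G \<Longrightarrow> \<chi> (g \<otimes> h) = \<chi> g * \<chi> h"
    "\<exists>g\<in>carrier G. \<chi> g \<noteq> 1"
proof -
  define A where "A = {H. subgroup H G \<and> H \<noteq> carrier G}"
  have "A \<subseteq> Pow (carrier G)" by (auto simp: A_def dest: subgroup.subset)
  then have "finite A" using fin by (meson finite_Pow_iff finite_subset)
  moreover have "squares_subgroup G \<in> A"
    using ne squares_subgroup_is_subgroup by (auto simp: A_def)
  ultimately obtain H where H: "H \<in> A" "squares_subgroup G \<subseteq> H"
    and max: "\<forall>K\<in>A. H \<subseteq> K \<longrightarrow> H = K"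
    using finite_has_maximal2 by metis
  have sub: "subgroup H G" using H by (simp add: A_def)
  have sq: "g \<otimes> g \<in> H" if "g \<in> carrier G" for g
    using that H square_in_squares_subgroup by blast
  have prod: "x \<otimes> y \<in> H" if "x \<in> carrier G" "x \<notin> H" "y \<in> carrier G" "y \<notin> H" for x y
    by (rule maximal_subgroup_of_squares_index_two[OF sub sq])
       (use that max in \<open>auto simp: A_def\<close>)
  define \<chi> :: "'a \<Rightarrow> complex" where "\<chi> g = (if g \<in> H then 1 else -1)" for g
  show thesis
  proof
    show "\<chi> g = 1 \<or> \<chi> g = -1" for g by (simp add: \<chi>_def)
    show "\<chi> (g \<otimes> h) = \<chi> g * \<chi> h" if "g \<in> carrier G" "h \<in> carrier G" for g h
      using index_two_sign_multiplicative[OF sub prod that] by (simp add: \<chi>_def)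
    show "\<exists>g\<in>carrier G. \<chi> g \<noteq> 1"
      using H subgroup.subset[OF sub] by (auto simp: \<chi>_def A_def)
  qed
qed

subsection \<open>Parity of the order of the abelianization\<close>

text \<open>If the quotient has order n = 2k + 1, then g^n lies in \<open>G'\<close>, hence in
  \<open>G_1\<close>, while g^(n+1) is the square of g^(k+1). Dividing the two leaves g in
  \<open>G_1\<close>.\<close>

lemma odd_abelianization_imp_squares_generate:
  assumes odd: "odd (Coset.order (G Mod derived G (carrier G)))"
  shows "carrier G = squares_subgroup G"
proof -
  let ?D = "derived G (carrier G)"
  interpret D: normal ?D G by (rule derived_self_is_normal)
  interpret Q: group "G Mod ?D" by (rule derived_quot_is_group)
  interpret S: subgroup "squares_subgroup G" G by (rule squares_subgroup_is_subgroup)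
  obtain k where k: "Coset.order (G Mod ?D) = Suc (2 * k)"
    using odd by (auto elim: oddE)
  have "g \<in> squares_subgroup G" if g: "g \<in> carrier G" for g
  proof -
    let ?n = "Suc (2 * k)"
    have "?D #> g \<in> carrier (G Mod ?D)" using g by (auto simp: carrier_FactGroup)
    then have "(?D #> g) [^]\<^bsub>G Mod ?D\<^esub> ?n = ?D"
      using Q.pow_order_eq_1[of "?D #> g"] by (simp only: k one_FactGroup)
    then have "?D #> (g [^] ?n) = ?D" using D.FactGroup_pow[OF g] by (simp only:)
    then have "g [^] ?n \<in> ?D"
      using g coset_join1 D.subgroup_axioms by blast
    then have "g [^] ?n \<in> squares_subgroup G" using derived_subset_squares_subgroup by blast
    moreover have "g [^] Suc k \<otimes> g [^] Suc k \<in> squares_subgroup G"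
      using g by (intro square_in_squares_subgroup) simp
    ultimately have "inv (g [^] ?n) \<otimes> (g [^] Suc k \<otimes> g [^] Suc k) \<in> squares_subgroup G"
      by (rule S.m_closed[OF S.m_inv_closed])
    also have "g [^] Suc k \<otimes> g [^] Suc k = g [^] ?n \<otimes> g"
      using g nat_pow_mult[of g "Suc k" "Suc k"] nat_pow_Suc[of g "?n"] by (simp add: mult_2)
    also have "inv (g [^] ?n) \<otimes> (g [^] ?n \<otimes> g) = g"
      using g by (intro inv_cancel_left nat_pow_closed)
    finally show ?thesis .
  qed
  then show ?thesis using squares_subgroup_subset by blast
qed

text \<open>An involution has the same square as the identity, so squaring is not injective and, on
  a finite set, not surjective.\<close>

lemma even_order_not_all_squares:
  assumes fin: "finite (carrier G)" and even: "even (Coset.order G)"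
  obtains y where "y \<in> carrier G" "\<And>x. x \<in> carrier G \<Longrightarrow> x \<otimes> x \<noteq> y"
proof -
  \<comment> \<open>Sylow's theorem is applied with exponent 1 and \<open>m\<close> possibly even,
    so the subgroup has exactly two elements.\<close>
  obtain m where "Coset.order G = 2 ^ 1 * m" using even by (auto elim: evenE)
  then obtain T where T: "subgroup T G" "card T = 2"
    using sylow_thm[of 2 G 1 m] fin is_group by auto
  interpret T: subgroup T G by (rule T)
  obtain t where Teq: "T = {\<one>, t}" "t \<noteq> \<one>"
    using T(2) T.one_closed by (metis card_2_iff doubleton_eq_iff insertE singletonD)
  have t: "t \<in> carrier G" "t \<otimes> t \<in> T" using Teq(1) T.mem_carrier T.m_closed by blast+
  then have "t \<otimes> t = \<one> \<or> t \<otimes> t = t" using Teq(1) by blast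
  then have tt: "t \<otimes> t = \<one>" using Teq(2) t(1) by simp
  have "\<not> inj_on (\<lambda>x. x \<otimes> x) (carrier G)"
    using tt t Teq(2) unfolding inj_on_def by (metis l_one one_closed)
  then have "\<not> carrier G \<subseteq> (\<lambda>x. x \<otimes> x) ` carrier G"
    using finite_surj_inj[OF fin] by blast
  then show thesis using that by auto
qed

text \<open>Squaring is an endomorphism of an abelian group, so its image is already a subgroup. A
  non-square therefore lies outside the generated subgroup.\<close>

lemma (in comm_group) squares_subgroup_eq_squares:
  "squares_subgroup G = {g \<otimes> g | g. g \<in> carrier G}"
proof
  have "subgroup {g \<otimes> g | g. g \<in> carrier G} G"
  proof (rule subgroupI)
    fix a b assume "a \<in> {g \<otimes> g | g. g \<in> carrier G}" "b \<in> {g \<otimes> g | g. g \<in> carrier G}"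
    then obtain x y where "a = x \<otimes> x" "b = y \<otimes> y" "x \<in> carrier G" "y \<in> carrier G" by auto
    then have "a \<otimes> b = (x \<otimes> y) \<otimes> (x \<otimes> y)" "x \<otimes> y \<in> carrier G" by (simp_all add: m_ac)
    then show "a \<otimes> b \<in> {g \<otimes> g | g. g \<in> carrier G}" by blast
  next
    fix a assume "a \<in> {g \<otimes> g | g. g \<in> carrier G}"
    then obtain x where "a = x \<otimes> x" "x \<in> carrier G" by auto
    then have "inv a = inv x \<otimes> inv x" "inv x \<in> carrier G" by (simp_all add: inv_mult)
    then show "inv a \<in> {g \<otimes> g | g. g \<in> carrier G}" by blast
  qed auto
  then show "squares_subgroup G \<subseteq> {g \<otimes> g | g. g \<in> carrier G}"
    by (rule squares_subgroup_minimal) auto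
qed (auto intro: square_in_squares_subgroup)

text \<open>The preimage of the squares subgroup of \<open>K\<close> is a subgroup of
  \<open>G\<close> containing every square.\<close>

lemma hom_squares_subgroup:
  assumes "group K" "f \<in> hom G K" "g \<in> squares_subgroup G"
  shows "f g \<in> squares_subgroup K"
proof -
  interpret K: group K by (rule assms(1))
  interpret f: group_hom G K f
    using assms by (simp add: group_hom_def group_hom_axioms_def is_group)
  have "subgroup {g \<in> carrier G. f g \<in> squares_subgroup K} G"
    using K.squares_subgroup_is_subgroup
    by (auto intro!: subgroupI simp: subgroup.one_closed subgroup.m_closed subgroup.m_inv_closed
        intro: exI[of _ \<one>])
  then have "squares_subgroup G \<subseteq> {g \<in> carrier G. f g \<in> squares_subgroup K}"
    by (rule squares_subgroup_minimal) (auto intro: K.square_in_squares_subgroup)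
  with assms(3) show ?thesis by auto
qed

text \<open>If the squares generated \<open>G\<close>, their images would generate the abelian
  quotient, where every element would then be a square; even order forbids this.\<close>

lemma even_abelianization_imp_squares_not_generate:
  assumes fin: "finite (carrier G)" and even: "even (Coset.order (G Mod derived G (carrier G)))"
  shows "carrier G \<noteq> squares_subgroup G"
proof
  let ?D = "derived G (carrier G)"
  interpret D: normal ?D G by (rule derived_self_is_normal)
  interpret Q: comm_group "G Mod ?D" by (rule derived_quot_is_comm_group)
  assume eq: "carrier G = squares_subgroup G"
  have "finite (carrier (G Mod ?D))" using fin by (simp add: carrier_FactGroup)
  then obtain y where y: "y \<in> carrier (G Mod ?D)"
    "\<And>x. x \<in> carrier (G Mod ?D) \<Longrightarrow> x \<otimes>\<^bsub>G Mod ?D\<^esub> x \<noteq> y"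
    using Q.even_order_not_all_squares even by blast
  obtain g where "g \<in> carrier G" "y = ?D #> g" using y(1) by (auto simp: carrier_FactGroup)
  then have "y \<in> squares_subgroup (G Mod ?D)"
    using hom_squares_subgroup[OF Q.is_group D.r_coset_hom_Mod] eq by simp
  then show False using y(2) unfolding Q.squares_subgroup_eq_squares by blast
qed

end

section \<open>Random walks on finite groups\<close>

text \<open>A real-valued copy of \<open>conv_power\<close>, so that positivity and order estimates
  can be used.\<close>

primrec walk_prob :: "('a, 'b) monoid_scheme \<Rightarrow> ('a \<Rightarrow> real) \<Rightarrow> nat \<Rightarrow> 'a \<Rightarrow> real" where
  "walk_prob G p 0 h = (if h = \<one>\<^bsub>G\<^esub> then 1 else 0)"
| "walk_prob G p (Suc n) h = (\<Sum>g\<in>carrier G. p g * walk_prob G p n (inv\<^bsub>G\<^esub> g \<otimes>\<^bsub>G\<^esub> h))"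

lemma conv_power_of_real:
  "conv_power G (\<lambda>g. of_real (p g)) n h = of_real (walk_prob G p n h)"
  by (induction n arbitrary: h) (simp_all add: convolution_def)

text \<open>The squared norm is the mean of the squared moduli over a finite set: each modulus is
  controlled by the norm, and finitely many null sequences have a null sum.\<close>

lemma converges_on_iff_pointwise:
  assumes "finite (carrier G)"
  shows "converges_on G F L \<longleftrightarrow> (\<forall>g\<in>carrier G. (\<lambda>n. F n g) \<longlonglongrightarrow> L g)"
proof -
  have norm_eq: "group_norm G F = sqrt ((\<Sum>g\<in>carrier G. (cmod (F g))\<^sup>2) / real (Coset.order G))"
    for F :: "'a \<Rightarrow> complex"
  proof -
    have "scalar_product G F F = of_real ((\<Sum>g\<in>carrier G. (cmod (F g))\<^sup>2) / real (Coset.order G))"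
      by (simp add: scalar_product_def complex_norm_square flip: of_real_power)
    then show ?thesis by (simp add: group_norm_def)
  qed
  show ?thesis
  proof
    assume conv: "converges_on G F L"
    show "\<forall>g\<in>carrier G. (\<lambda>n. F n g) \<longlonglongrightarrow> L g"
    proof
      fix g assume g: "g \<in> carrier G"
      have pos: "real (Coset.order G) > 0" using assms g by (auto simp: Coset.order_def card_gt_0_iff)
      have bound: "cmod (F n g - L g) \<le> sqrt (Coset.order G) * group_norm G (\<lambda>g. F n g - L g)" for n
      proof -
        have "(cmod (F n g - L g))\<^sup>2 \<le> (\<Sum>g\<in>carrier G. (cmod (F n g - L g))\<^sup>2)"
          using assms g by (intro member_le_sum) auto
        then show ?thesis
          using pos by (simp add: norm_eq real_sqrt_divide real_le_rsqrt)
      qed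
      have lim: "(\<lambda>n. sqrt (Coset.order G) * group_norm G (\<lambda>g. F n g - L g)) \<longlonglongrightarrow> 0"
        using conv unfolding converges_on_def by (rule tendsto_mult_right_zero)
      have "(\<lambda>n. cmod (F n g - L g)) \<longlonglongrightarrow> 0"
        by (rule tendsto_sandwich[OF _ _ tendsto_const lim]) (simp_all add: bound)
      then have "(\<lambda>n. F n g - L g) \<longlonglongrightarrow> 0" by (rule tendsto_norm_zero_cancel)
      then show "(\<lambda>n. F n g) \<longlonglongrightarrow> L g" by (simp add: LIM_zero_iff)
    qed
  next
    assume "\<forall>g\<in>carrier G. (\<lambda>n. F n g) \<longlonglongrightarrow> L g"
    then have "(\<lambda>n. \<Sum>g\<in>carrier G. (cmod (F n g - L g))\<^sup>2) \<longlonglongrightarrow> (\<Sum>g\<in>carrier G. (cmod (L g - L g))\<^sup>2)"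
      by (intro tendsto_sum tendsto_power tendsto_norm tendsto_diff tendsto_const) blast
    then have "(\<lambda>n. \<Sum>g\<in>carrier G. (cmod (F n g - L g))\<^sup>2) \<longlonglongrightarrow> 0" by simp
    from tendsto_real_sqrt[OF tendsto_divide_zero[OF this, of "real (Coset.order G)"]]
    have "(\<lambda>n. sqrt ((\<Sum>g\<in>carrier G. (cmod (F n g - L g))\<^sup>2) / real (Coset.order G))) \<longlonglongrightarrow> 0"
      by simp
    then show "converges_on G F L" by (simp add: converges_on_def norm_eq)
  qed
qed

context group
begin

lemma sum_translate:
  assumes "k \<in> carrier G"
  shows "(\<Sum>g\<in>carrier G. f (k \<otimes> g)) = (\<Sum>g\<in>carrier G. f g)"
proof -
  have "bij_betw (\<lambda>g. k \<otimes> g) (carrier G) (carrier G)"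
    using assms by (simp add: bij_betw_def inj_on_cmult surj_const_mult)
  then show ?thesis by (rule sum.reindex_bij_betw)
qed

lemma sum_inv_translate:
  assumes "h \<in> carrier G"
  shows "(\<Sum>g\<in>carrier G. f (inv g \<otimes> h)) = (\<Sum>g\<in>carrier G. f g)"
proof -
  have "bij_betw (\<lambda>g. inv g \<otimes> h) (carrier G) (carrier G)"
  proof (rule bij_betw_byWitness[where f' = "\<lambda>g. h \<otimes> inv g"])
  qed (use assms in \<open>auto simp: inv_mult_group m_assoc inv_cancel_left\<close>)
  then show ?thesis by (rule sum.reindex_bij_betw)
qed

end

section \<open>Random walks with a fixed step distribution\<close>

locale random_walk = group +
  fixes p :: "'a \<Rightarrow> real"
  assumes finite_carrier: "finite (carrier G)"
    and step_nonneg: "g \<in> carrier G \<Longrightarrow> p g \<ge> 0"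
    and step_sum: "(\<Sum>g\<in>carrier G. p g) = 1"
begin

abbreviation walk :: "nat \<Rightarrow> 'a \<Rightarrow> real" where "walk \<equiv> walk_prob G p"

lemma walk_nonneg: "h \<in> carrier G \<Longrightarrow> walk n h \<ge> 0"
  by (induction n arbitrary: h) (auto intro!: sum_nonneg mult_nonneg_nonneg step_nonneg)

text \<open>The Chapman-Kolmogorov equation, that is, associativity of convolution.\<close>

lemma walk_add:
  assumes "h \<in> carrier G"
  shows "walk (m + n) h = (\<Sum>g\<in>carrier G. walk m g * walk n (inv g \<otimes> h))"
  using assms
proof (induction m arbitrary: h)
  case 0
  have "(\<Sum>g\<in>carrier G. walk 0 g * walk n (inv g \<otimes> h))
      = (\<Sum>g\<in>carrier G. if g = \<one> then walk n (inv g \<otimes> h) else 0)"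
    by (intro sum.cong) auto
  then show ?case using 0 finite_carrier by simp
next
  case (Suc m)
  have "walk (Suc m + n) h
      = (\<Sum>k\<in>carrier G. p k * (\<Sum>g\<in>carrier G. walk m g * walk n (inv g \<otimes> (inv k \<otimes> h))))"
    using Suc by simp
  \<comment> \<open>The inner variable is translated by \<open>k\<close>, after which the sum over
    \<open>k\<close> can be carried out first.\<close>
  also have "\<dots> = (\<Sum>k\<in>carrier G. p k * (\<Sum>g\<in>carrier G. walk m (inv k \<otimes> g) * walk n (inv g \<otimes> h)))"
  proof (rule sum.cong[OF refl], rule arg_cong2[where f = "(*)", OF refl])
    fix k assume k: "k \<in> carrier G"
    have "(\<Sum>g\<in>carrier G. walk m g * walk n (inv g \<otimes> (inv k \<otimes> h)))
        = (\<Sum>g\<in>carrier G. walk m (inv k \<otimes> (k \<otimes> g)) * walk n (inv (k \<otimes> g) \<otimes> h))"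
    proof (rule sum.cong[OF refl])
      fix g assume g: "g \<in> carrier G"
      have "inv k \<otimes> (k \<otimes> g) = g" using inv_cancel_left k g by blast
      moreover have "inv (k \<otimes> g) \<otimes> h = inv g \<otimes> (inv k \<otimes> h)"
        using k g Suc.prems by (simp add: inv_mult_group m_assoc)
      ultimately show "walk m g * walk n (inv g \<otimes> (inv k \<otimes> h))
          = walk m (inv k \<otimes> (k \<otimes> g)) * walk n (inv (k \<otimes> g) \<otimes> h)" by (simp only:)
    qed
    also have "\<dots> = (\<Sum>g\<in>carrier G. walk m (inv k \<otimes> g) * walk n (inv g \<otimes> h))"
      using k by (rule sum_translate)
    finally show "(\<Sum>g\<in>carrier G. walk m g * walk n (inv g \<otimes> (inv k \<otimes> h)))
        = (\<Sum>g\<in>carrier G. walk m (inv k \<otimes> g) * walk n (inv g \<otimes> h))" .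
  qed
  also have "\<dots> = (\<Sum>g\<in>carrier G. walk (Suc m) g * walk n (inv g \<otimes> h))"
    by (simp add: sum_distrib_left sum_distrib_right mult.assoc) (rule sum.swap)
  finally show ?case .
qed

lemma walk_sum: "(\<Sum>h\<in>carrier G. walk n h) = 1"
proof (induction n)
  case 0
  then show ?case using finite_carrier by simp
next
  case (Suc n)
  have "(\<Sum>h\<in>carrier G. walk (Suc n) h)
      = (\<Sum>g\<in>carrier G. p g * (\<Sum>h\<in>carrier G. walk n (inv g \<otimes> h)))"
    by (simp add: sum_distrib_left) (rule sum.swap)
  also have "\<dots> = (\<Sum>g\<in>carrier G. p g)"
  proof (rule sum.cong[OF refl])
    fix g assume "g \<in> carrier G"
    then have "(\<Sum>h\<in>carrier G. walk n (inv g \<otimes> h)) = 1"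
      using sum_translate[of "inv g" "walk n"] Suc by (simp only: inv_closed)
    then show "p g * (\<Sum>h\<in>carrier G. walk n (inv g \<otimes> h)) = p g" by (simp only: mult_1_right)
  qed
  finally show ?case by (simp add: step_sum)
qed

text \<open>The path through \<open>g\<close> at time \<open>m\<close> contributes a positive term
  to a sum of nonnegative ones.\<close>

lemma walk_add_pos:
  assumes "g \<in> carrier G" "h \<in> carrier G" "walk m g > 0" "walk n h > 0"
  shows "walk (m + n) (g \<otimes> h) > 0"
proof -
  have "walk (m + n) (g \<otimes> h) = (\<Sum>k\<in>carrier G. walk m k * walk n (inv k \<otimes> (g \<otimes> h)))"
    using assms by (simp add: walk_add)
  also have "\<dots> > 0"
  proof (rule sum_pos2[OF finite_carrier assms(1)])
    show "walk m g * walk n (inv g \<otimes> (g \<otimes> h)) > 0"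
      using assms by (simp flip: m_assoc)
  qed (use assms walk_nonneg in auto)
  finally show ?thesis .
qed

lemma walk_one: "h \<in> carrier G \<Longrightarrow> walk 1 h = p h"
proof -
  assume h: "h \<in> carrier G"
  have "walk 1 h = (\<Sum>g\<in>carrier G. if g = h then p g else 0)"
    unfolding One_nat_def walk_prob.simps
  proof (intro sum.cong refl)
    fix g assume "g \<in> carrier G"
    then have "inv g \<otimes> h = \<one> \<longleftrightarrow> g = h" using h by (metis inv_closed inv_equality inv_inv l_inv)
    then show "p g * (if inv g \<otimes> h = \<one> then 1 else 0) = (if g = h then p g else 0)" by simp
  qed
  then show ?thesis using h finite_carrier by simp
qed

text \<open>A lazy walk can wait at the identity for the extra steps, so a reachable element stays
  reachable.\<close>

lemma walk_pos_mono:
  assumes lazy: "p \<one> > 0" and "h \<in> carrier G" "walk m h > 0" "m \<le> n"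
  shows "walk n h > 0"
  using \<open>m \<le> n\<close>
proof (induction n rule: dec_induct)
  case (step n)
  then show ?case using walk_add_pos[of \<one> h 1 n] assms walk_one[of \<one>] by (simp del: walk_prob.simps)
qed (fact assms)

lemma eventually_positive:
  assumes lazy: "p \<one> > 0" and irred: "\<And>g. g \<in> carrier G \<Longrightarrow> \<exists>n. walk n g > 0"
  obtains N where "\<And>g. g \<in> carrier G \<Longrightarrow> walk N g > 0"
proof -
  obtain n where n: "\<And>g. g \<in> carrier G \<Longrightarrow> walk (n g) g > 0" using irred by metis
  \<comment> \<open>The sum is merely a common upper bound for the finitely many times
    \<open>n g\<close>.\<close>
  have "walk (\<Sum>g\<in>carrier G. n g) g > 0" if "g \<in> carrier G" for g
    by (rule walk_pos_mono[OF lazy that n[OF that]]) (use finite_carrier that in \<open>simp add: member_le_sum\<close>)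
  then show thesis by (rule that)
qed

text \<open>Doeblin's contraction: the part \<open>\<epsilon>\<close> of \<open>walk N\<close> averages the deviation from uniformity,
  which has mean zero, so only the remaining mass \<open>1 - \<epsilon> |G|\<close> contributes.\<close>

lemma doeblin_contraction:
  fixes \<epsilon> B :: real
  assumes minor: "\<And>g. g \<in> carrier G \<Longrightarrow> walk N g \<ge> \<epsilon>"
    and bound: "\<And>g. g \<in> carrier G \<Longrightarrow> \<bar>walk n g - 1 / Coset.order G\<bar> \<le> B"
    and h: "h \<in> carrier G"
  shows "\<bar>walk (N + n) h - 1 / Coset.order G\<bar> \<le> (1 - \<epsilon> * Coset.order G) * B"
proof -
  let ?u = "1 / real (Coset.order G)"
  have pos: "real (Coset.order G) > 0"
    using finite_carrier by (auto simp: Coset.order_def card_gt_0_iff)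
  have "(\<Sum>g\<in>carrier G. walk n (inv g \<otimes> h) - ?u) = 0"
    using sum_inv_translate[OF h, of "walk n"] pos by (simp add: sum_subtractf walk_sum Coset.order_def)
  then have "walk (N + n) h - ?u = (\<Sum>g\<in>carrier G. walk N g * (walk n (inv g \<otimes> h) - ?u))
      - \<epsilon> * (\<Sum>g\<in>carrier G. walk n (inv g \<otimes> h) - ?u)"
    by (simp add: walk_add[OF h] right_diff_distrib sum_subtractf walk_sum flip: sum_divide_distrib)
  also have "\<dots> = (\<Sum>g\<in>carrier G. (walk N g - \<epsilon>) * (walk n (inv g \<otimes> h) - ?u))"
    by (simp add: sum_distrib_left left_diff_distrib flip: sum_subtractf)
  also have "\<bar>\<dots>\<bar> \<le> (\<Sum>g\<in>carrier G. (walk N g - \<epsilon>) * B)"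
  proof (rule order_trans[OF sum_abs], rule sum_mono)
    fix g assume "g \<in> carrier G"
    then show "\<bar>(walk N g - \<epsilon>) * (walk n (inv g \<otimes> h) - ?u)\<bar> \<le> (walk N g - \<epsilon>) * B"
      using minor[of g] bound[of "inv g \<otimes> h"] h by (simp add: abs_mult mult_left_mono)
  qed
  also have "\<dots> = (1 - \<epsilon> * Coset.order G) * B"
    by (simp add: sum_subtractf walk_sum Coset.order_def mult.commute[of \<epsilon>] flip: sum_distrib_right)
  finally show ?thesis .
qed

text \<open>Once all elements are reachable at a common time \<open>N\<close>, every block of
  \<open>N\<close> steps shrinks the deviation from uniformity by a factor \<open>c\<close> below
  1.\<close>

theorem walk_tendsto_uniform:
  assumes lazy: "p \<one> > 0" and irred: "\<And>g. g \<in> carrier G \<Longrightarrow> \<exists>n. walk n g > 0"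
    and h: "h \<in> carrier G"
  shows "(\<lambda>n. walk n h) \<longlonglongrightarrow> 1 / Coset.order G"
proof -
  let ?u = "1 / real (Coset.order G)"
  have pos: "real (Coset.order G) > 0"
    using finite_carrier by (auto simp: Coset.order_def card_gt_0_iff)
  obtain N where N: "\<And>g. g \<in> carrier G \<Longrightarrow> walk N g > 0"
    using eventually_positive[OF lazy irred] by metis
  \<comment> \<open>The minimum over a finite set is attained, hence positive, which gives
    \<open>c\<close> < 1; total mass 1 gives \<open>c\<close> \<ge> 0.\<close>
  define \<epsilon> where "\<epsilon> = Min (walk N ` carrier G)"
  define c where "c = 1 - \<epsilon> * Coset.order G"
  have min: "walk N g \<ge> \<epsilon>" if "g \<in> carrier G" for g
    using that finite_carrier by (simp add: \<epsilon>_def)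
  have "\<epsilon> \<in> walk N ` carrier G"
    unfolding \<epsilon>_def using finite_carrier by (intro Min_in) auto
  then have "\<epsilon> > 0" using N by auto
  then have c1: "c < 1" using pos by (simp add: c_def)
  have "(\<Sum>g\<in>carrier G. \<epsilon>) \<le> (\<Sum>g\<in>carrier G. walk N g)" by (intro sum_mono min)
  then have c0: "c \<ge> 0" by (simp add: walk_sum c_def Coset.order_def mult.commute)
  have step: "\<bar>walk (Suc n) g - ?u\<bar> \<le> B"
    if "\<And>g. g \<in> carrier G \<Longrightarrow> \<bar>walk n g - ?u\<bar> \<le> B" "g \<in> carrier G" for n B g
    using doeblin_contraction[of 0 1 n B g] walk_nonneg[of _ 1] that by simp
  \<comment> \<open>The offset \<open>r\<close> is arbitrary. For \<open>k\<close> = 0 both numbers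
    lie in [0, 1], so they differ by at most 1.\<close>
  have geo: "\<bar>walk (r + N * k) g - ?u\<bar> \<le> c ^ k" if "g \<in> carrier G" for k r g
    using that
  proof (induction k arbitrary: g)
    case 0
    have "walk r g \<le> 1"
      using member_le_sum[of g "carrier G" "walk r"] 0 walk_sum walk_nonneg finite_carrier by auto
    moreover have "?u \<le> 1" using pos by (simp add: Coset.order_def)
    moreover have "walk r g \<ge> 0" using 0 by (rule walk_nonneg)
    moreover have "?u \<ge> 0" by simp
    ultimately have "\<bar>walk r g - ?u\<bar> \<le> 1" by linarith
    then show ?case by simp
  next
    case (Suc k)
    have "\<bar>walk (N + (r + N * k)) g - ?u\<bar> \<le> c * c ^ k"
      unfolding c_def by (rule doeblin_contraction[OF min _ Suc.prems]) (use Suc.IH c_def in auto)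
    then show ?case by (simp add: algebra_simps)
  qed
  show ?thesis
  proof (rule LIMSEQ_I)
    fix r :: real assume "r > 0"
    then obtain k where k: "c ^ k < r" using c0 c1 real_arch_pow_inv by blast
    \<comment> \<open>Taking the offset to be \<open>n - N * k\<close> covers all large times, not
      only multiples of \<open>N\<close>.\<close>
    have "norm (walk n h - ?u) < r" if "n \<ge> N * k" for n
      using geo[OF h, of "n - N * k" k] k that by simp
    then show "\<exists>no. \<forall>n\<ge>no. norm (walk n h - ?u) < r" by blast
  qed
qed

text \<open>The walk starts at the identity and each step multiplies by an element of
  \<open>H\<close>. With \<open>H\<close> = \<open>G_1\<close> this is the obstruction to
  convergence.\<close>

lemma walk_support:
  assumes H: "subgroup H G" and supp: "\<And>g. g \<in> carrier G \<Longrightarrow> p g \<noteq> 0 \<Longrightarrow> g \<in> H"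
    and "h \<in> carrier G" "walk n h \<noteq> 0"
  shows "h \<in> H"
  using assms(3,4)
proof (induction n arbitrary: h)
  case 0
  then show ?case using subgroup.one_closed[OF H] by (auto split: if_splits)
next
  case (Suc n)
  then have "(\<Sum>g\<in>carrier G. p g * walk n (inv g \<otimes> h)) \<noteq> 0" by simp
  then obtain g where g: "g \<in> carrier G" "p g * walk n (inv g \<otimes> h) \<noteq> 0"
    by (rule sum.not_neutral_contains_not_neutral)
  then have "g \<in> H" "inv g \<otimes> h \<in> H"
    using supp Suc.IH[of "inv g \<otimes> h"] Suc.prems(1) by auto
  then have "g \<otimes> (inv g \<otimes> h) \<in> H" by (rule subgroup.m_closed[OF H])
  then show ?case using g(1) Suc.prems(1) by (simp only: inv_cancel_left)
qed

end

subsection \<open>The square root walk\<close>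

lemma (in group) sqrt_count_pos_iff:
  assumes "finite (carrier G)"
  shows "sqrt_count G g > 0 \<longleftrightarrow> (\<exists>h\<in>carrier G. h \<otimes> h = g)"
  using assms by (auto simp: sqrt_count_def card_gt_0_iff)

lemma (in group) random_walk_sqrt:
  assumes fin: "finite (carrier G)"
  shows "random_walk G (\<lambda>g. real (sqrt_count G g) / Coset.order G)"
proof
  \<comment> \<open>Each \<open>h\<close> is counted exactly once, at the element that is its
    square.\<close>
  have "(\<Sum>g\<in>carrier G. sqrt_count G g) = card (carrier G)"
    using sum.group[OF fin fin, of "\<lambda>h. h \<otimes> h" "\<lambda>_. 1 :: nat"] by (auto simp: sqrt_count_def)
  moreover have "card (carrier G) > 0" using fin by (auto simp: card_gt_0_iff)
  ultimately show "(\<Sum>g\<in>carrier G. real (sqrt_count G g) / Coset.order G) = 1"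
    by (simp add: Coset.order_def flip: sum_divide_distrib of_nat_sum)
qed (use fin in auto)

text \<open>The step distribution is positive exactly at the squares. If they generate
  \<open>G\<close>, the walk is lazy and reaches everything; otherwise its probability at a point
  outside \<open>G_1\<close> is always 0 and cannot tend to 1/|G|.\<close>

lemma (in group) sqrt_walk_converges_iff:
  assumes fin: "finite (carrier G)"
  shows "converges_on G (conv_power G (sqrt_prob G)) (uniform_prob G)
    \<longleftrightarrow> carrier G = squares_subgroup G"
proof -
  define p where "p = (\<lambda>g. real (sqrt_count G g) / Coset.order G)"
  interpret random_walk G p unfolding p_def by (rule random_walk_sqrt[OF fin])
  have order_pos: "Coset.order G > 0" using fin by (auto simp: Coset.order_def card_gt_0_iff)
  have p_pos: "p g > 0 \<longleftrightarrow> (\<exists>h\<in>carrier G. h \<otimes> h = g)" for g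
    using sqrt_count_pos_iff[OF fin, of g] order_pos by (simp add: p_def zero_less_divide_iff)
  have "sqrt_prob G = (\<lambda>g. of_real (p g))" by (auto simp: sqrt_prob_def p_def)
  then have "converges_on G (conv_power G (sqrt_prob G)) (uniform_prob G)
    \<longleftrightarrow> (\<forall>h\<in>carrier G. (\<lambda>n. complex_of_real (walk n h)) \<longlonglongrightarrow> of_real (1 / Coset.order G))"
    by (simp add: converges_on_iff_pointwise[OF fin] conv_power_of_real uniform_prob_def)
  then have conv: "converges_on G (conv_power G (sqrt_prob G)) (uniform_prob G)
    \<longleftrightarrow> (\<forall>h\<in>carrier G. (\<lambda>n. walk n h) \<longlonglongrightarrow> 1 / Coset.order G)"
    by (simp only: tendsto_of_real_iff)
  show ?thesis
  proof
    assume eq: "carrier G = squares_subgroup G"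
    have pos: "walk 1 (h \<otimes> h) > 0" if "h \<in> carrier G" for h
      using that p_pos walk_one by auto
    have "\<exists>n. walk n g > 0" if "g \<in> generate G {g \<otimes> g | g. g \<in> carrier G}" for g
      using that
    proof induction
      case one
      then show ?case using pos[of \<one>] by (metis l_one one_closed)
    next
      case (incl h)
      then show ?case using pos by blast
    next
      \<comment> \<open>The inverse of a square is a square, so one step still suffices.\<close>
      case (inv h)
      then obtain g where "g \<in> carrier G" "h = g \<otimes> g" by auto
      then show ?case using pos[of "inv g"] by (metis inv_closed inv_mult_group)
    next
      case (eng g h)
      moreover from eng have "g \<in> carrier G" "h \<in> carrier G"
        using squares_subgroup_subset unfolding squares_subgroup_def by auto
      ultimately show ?case using walk_add_pos by blast
    qed
    then have irred: "\<exists>n. walk n g > 0" if "g \<in> carrier G" for g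
      using that eq unfolding squares_subgroup_def by simp
    have "p \<one> > 0" using p_pos by force
    then show "converges_on G (conv_power G (sqrt_prob G)) (uniform_prob G)"
      unfolding conv using walk_tendsto_uniform irred by blast
  next
    assume "converges_on G (conv_power G (sqrt_prob G)) (uniform_prob G)"
    then have lim: "(\<lambda>n. walk n h) \<longlonglongrightarrow> 1 / Coset.order G" if "h \<in> carrier G" for h
      using that unfolding conv by blast
    have "h \<in> squares_subgroup G" if h: "h \<in> carrier G" for h
    proof (rule ccontr)
      assume "h \<notin> squares_subgroup G"
      moreover have "g \<in> squares_subgroup G" if "g \<in> carrier G" "p g \<noteq> 0" for g
        using p_pos[of g] step_nonneg[of g] that square_in_squares_subgroup by force
      ultimately have "walk n h = 0" for n
        using walk_support[OF squares_subgroup_is_subgroup _ h] by blast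
      then have "(\<lambda>n. 0 :: real) \<longlonglongrightarrow> 1 / Coset.order G" using lim[OF h] by simp
      then show False using order_pos by (simp add: LIMSEQ_const_iff)
    qed
    then show "carrier G = squares_subgroup G" using squares_subgroup_subset by blast
  qed
qed

section \<open>Real linear characters\<close>

text \<open>A nonzero vector with one entry has every other such vector as a multiple. Hence
  representations of degree one are irreducible.\<close>

lemma subspace_dim_one:
  fixes W :: "complex vec set"
  assumes "VectorSpace.subspace class_ring W (module_vec TYPE(complex) 1)"
  shows "W = {0\<^sub>v 1} \<or> W = carrier_vec 1"
proof -
  interpret submodule class_ring W "module_vec TYPE(complex) 1"
    using assms by (simp add: VectorSpace.subspace_def)
  have sub: "W \<subseteq> carrier_vec 1" and zero: "0\<^sub>v 1 \<in> W"
    using subset zero_closed by (simp_all add: module_vec_simps)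
  have smult: "c \<cdot>\<^sub>v v \<in> W" if "v \<in> W" for c v
    using smult_closed[of c v] that by (simp add: module_vec_simps class_ring_simps)
  show ?thesis
  proof (cases "W \<subseteq> {0\<^sub>v 1}")
    case False
    then obtain v where v: "v \<in> W" "v \<noteq> 0\<^sub>v 1" by auto
    then have dim: "dim_vec v = 1" using sub by auto
    with v have "v $ 0 \<noteq> 0" by (auto simp: vec_eq_iff)
    have "w \<in> W" if "w \<in> carrier_vec 1" for w
    proof -
      have "w = (w $ 0 / v $ 0) \<cdot>\<^sub>v v"
        using that dim \<open>v $ 0 \<noteq> 0\<close> by (intro eq_vecI) auto
      then show ?thesis using smult[OF v(1)] by metis
    qed
    then show ?thesis using sub by blast
  qed (use zero in auto)
qed

section \<open>One-dimensional representations and their characters\<close>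

context group
begin

text \<open>Matrices of size one multiply like scalars. The assumption \<open>one\<close> excludes
  the zero function, which is multiplicative too.\<close>

lemma linear_rep_of_hom:
  fixes \<chi> :: "'a \<Rightarrow> complex"
  assumes mult: "\<And>g h. g \<in> carrier G \<Longrightarrow> h \<in> carrier G \<Longrightarrow> \<chi> (g \<otimes> h) = \<chi> g * \<chi> h"
    and one: "\<chi> \<one> = 1"
  shows "is_irreducible_rep G 1 (\<lambda>g. mat 1 1 (\<lambda>_. \<chi> g))"
proof -
  have prod: "mat 1 1 (\<lambda>_. a) * mat 1 1 (\<lambda>_. b) = mat 1 1 (\<lambda>_. a * b)" for a b :: complex
    by (intro eq_matI) (auto simp: scalar_prod_def)
  have id: "1\<^sub>m 1 = (mat 1 1 (\<lambda>_. 1) :: complex mat)" by (intro eq_matI) auto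
  have "mat 1 1 (\<lambda>_. \<chi> g) \<in> Units (ring_mat TYPE(complex) 1 ())" if g: "g \<in> carrier G" for g
  proof -
    have "\<chi> g * \<chi> (inv g) = 1" "\<chi> (inv g) * \<chi> g = 1"
      using g one by (simp_all flip: mult)
    then show ?thesis
      unfolding Units_def ring_mat_simps
      by (simp only: mem_Collect_eq prod id) (use prod in \<open>auto intro!: bexI[of _ "mat 1 1 (\<lambda>_. \<chi> (inv g))"]\<close>)
  qed
  then have "is_rep G 1 (\<lambda>g. mat 1 1 (\<lambda>_. \<chi> g))"
    by (auto simp: is_rep_def hom_def units_of_def ring_mat_simps mult prod[simplified])
  then show ?thesis using subspace_dim_one unfolding is_irreducible_rep_def by blast
qed

lemma rep_mult:
  assumes "is_rep G n \<rho>" "g \<in> carrier G" "h \<in> carrier G"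
  shows "\<rho> (g \<otimes> h) = \<rho> g * \<rho> h"
  using assms by (auto simp: is_rep_def hom_def units_of_def ring_mat_simps)

lemma rep_carrier_mat:
  assumes "is_rep G n \<rho>" "g \<in> carrier G"
  shows "\<rho> g \<in> carrier_mat n n"
  using assms by (auto simp: is_rep_def hom_def units_of_def Units_def ring_mat_simps)

text \<open>The trace of a matrix of size one is its only entry, so it inherits
  multiplicativity.\<close>

lemma linear_character_mult:
  assumes rep: "is_rep G 1 \<rho>" and g: "g \<in> carrier G" and h: "h \<in> carrier G"
  shows "rep_character G \<rho> (g \<otimes> h) = rep_character G \<rho> g * rep_character G \<rho> h"
  using rep_carrier_mat[OF rep g] rep_carrier_mat[OF rep h] g h
  by (simp add: rep_character_def mat_trace_def rep_mult[OF rep g h] scalar_prod_def)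

text \<open>The kernel of a nonprincipal real linear character is a proper subgroup containing all
  squares; conversely the sign homomorphism, read as a representation of degree one, is such a
  character.\<close>

lemma exists_real_linear_character_iff:
  assumes fin: "finite (carrier G)"
  shows "real_linear_characters G \<noteq> {} \<longleftrightarrow> carrier G \<noteq> squares_subgroup G"
proof
  assume "real_linear_characters G \<noteq> {}"
  then obtain n \<rho> where irr: "is_irreducible_rep G n \<rho>"
    and deg: "char_degree G (rep_character G \<rho>) = 1"
    and real: "\<And>g. g \<in> carrier G \<Longrightarrow> rep_character G \<rho> g \<in> \<real>"
    and ne: "rep_character G \<rho> \<noteq> principal_character G"
    by (auto simp: real_linear_characters_def real_irr_characters_def irr_characters_def)
  then have rep: "is_rep G 1 \<rho>"
    using char_degree_rep_character[OF is_group] by (auto simp: is_irreducible_rep_def)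
  define \<chi> where "\<chi> = rep_character G \<rho>"
  have one: "\<chi> \<one> = 1" using rep_character_one[OF is_group rep] by (simp add: \<chi>_def)
  have mult: "\<chi> (g \<otimes> h) = \<chi> g * \<chi> h" if "g \<in> carrier G" "h \<in> carrier G" for g h
    using linear_character_mult[OF rep] that by (simp add: \<chi>_def)
  have pow: "\<chi> (g [^] k) = \<chi> g ^ k" if "g \<in> carrier G" for g and k :: nat
    using that by (induction k) (simp_all add: one mult mult.commute)
  have sq: "\<chi> (g \<otimes> g) = 1" if g: "g \<in> carrier G" for g
  proof -
    \<comment> \<open>The value is a root of unity, hence of modulus 1; being real, it is 1 or -1
      and squares to 1.\<close>
    have "\<chi> g ^ Coset.order G = 1" using pow[OF g] pow_order_eq_1[OF g] one by metis
    then have "norm (\<chi> g) = 1"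
      using power_eq_1_iff fin by (fastforce simp: Coset.order_def)
    moreover obtain r where r: "\<chi> g = of_real r" using real[OF g] by (auto simp: \<chi>_def elim: Reals_cases)
    ultimately have "r * r = 1" by (auto simp: abs_eq_iff')
    then show ?thesis using g r by (simp add: mult flip: of_real_mult)
  qed
  have inv: "\<chi> (inv g) = 1" if "g \<in> carrier G" "\<chi> g = 1" for g
    using mult[of g "inv g"] that one by simp
  have "subgroup {g \<in> carrier G. \<chi> g = 1} G"
    by (rule subgroupI) (use one in \<open>auto simp: mult inv\<close>)
  then have "squares_subgroup G \<subseteq> {g \<in> carrier G. \<chi> g = 1}"
    by (rule squares_subgroup_minimal) (use sq in auto)
  moreover have "\<exists>g\<in>carrier G. \<chi> g \<noteq> 1"
    using ne unfolding \<chi>_def rep_character_def principal_character_def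
    by (metis (mono_tags, lifting) restrict_apply' restrict_ext)
  ultimately show "carrier G \<noteq> squares_subgroup G" by auto
next
  assume "carrier G \<noteq> squares_subgroup G"
  then obtain \<chi> :: "'a \<Rightarrow> complex" where
    sign: "\<And>g. g \<in> carrier G \<Longrightarrow> \<chi> g = 1 \<or> \<chi> g = -1" and
    mult: "\<And>g h. g \<in> carrier G \<Longrightarrow> h \<in> carrier G \<Longrightarrow> \<chi> (g \<otimes> h) = \<chi> g * \<chi> h" and
    nontriv: "\<exists>g\<in>carrier G. \<chi> g \<noteq> 1"
    by (rule exists_nontrivial_sign_hom[OF fin]) blast
  \<comment> \<open>The value at the identity is idempotent, which rules out -1.\<close>
  have "\<chi> \<one> = 1" using mult[of \<one> \<one>] sign[of \<one>] by auto
  then have irr: "is_irreducible_rep G 1 (\<lambda>g. mat 1 1 (\<lambda>_. \<chi> g))" (is "is_irreducible_rep G 1 ?\<rho>")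
    using linear_rep_of_hom mult by blast
  have char: "rep_character G ?\<rho> = (\<lambda>g\<in>carrier G. \<chi> g)"
    by (auto simp: rep_character_def mat_trace_def)
  have real: "(\<lambda>g\<in>carrier G. \<chi> g) g \<in> \<real>" if "g \<in> carrier G" for g
    using sign[OF that] that by auto
  have "rep_character G ?\<rho> \<in> irr_characters G" using irr by (auto simp: irr_characters_def)
  moreover have "rep_character G ?\<rho> g \<in> \<real>" if "g \<in> carrier G" for g
    unfolding char using that by (rule real)
  moreover have "rep_character G ?\<rho> \<noteq> principal_character G"
    unfolding char using nontriv by (auto simp: principal_character_def fun_eq_iff)
  moreover have "char_degree G (rep_character G ?\<rho>) = 1"
    using irr char_degree_rep_character[OF is_group] by (auto simp: is_irreducible_rep_def)
  ultimately show "real_linear_characters G \<noteq> {}"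
    by (auto simp: real_linear_characters_def real_irr_characters_def)
qed

text \<open>Irreducible degrees are at least 1, so 1 is least once attained. Conversely the least
  degree is attained only if some degree exists: \<open>LEAST\<close> over an empty set is
  unspecified, hence the nonemptiness clause.\<close>

lemma exists_real_linear_character_iff_min_degree:
  "real_linear_characters G \<noteq> {} \<longleftrightarrow> real_irr_characters G \<noteq> {} \<and> min_real_degree G = 1"
proof -
  have pos: "char_degree G \<chi> \<ge> 1" if "\<chi> \<in> real_irr_characters G" for \<chi>
    using that char_degree_rep_character[OF is_group]
    by (auto simp: real_irr_characters_def irr_characters_def is_irreducible_rep_def Suc_le_eq)
  show ?thesis
  proof
    assume "real_linear_characters G \<noteq> {}"
    then obtain \<chi> where \<chi>: "\<chi> \<in> real_irr_characters G" "char_degree G \<chi> = 1"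
      by (auto simp: real_linear_characters_def)
    have "min_real_degree G = 1"
      unfolding min_real_degree_def by (rule Least_equality) (use \<chi> pos in force)+
    with \<chi> show "real_irr_characters G \<noteq> {} \<and> min_real_degree G = 1" by auto
  next
    assume asm: "real_irr_characters G \<noteq> {} \<and> min_real_degree G = 1"
    then have "min_real_degree G \<in> char_degree G ` real_irr_characters G"
      unfolding min_real_degree_def by (metis LeastI equals0I image_eqI)
    with asm show "real_linear_characters G \<noteq> {}" by (auto simp: real_linear_characters_def)
  qed
qed

end

theorem mainTheorem3:
  fixes G :: "('a, 'b) monoid_scheme" (structure)
  assumes "group G" and "finite (carrier G)"
  shows "(\<not> converges_on G (conv_power G (sqrt_prob G)) (uniform_prob G)
            \<longleftrightarrow> real_linear_characters G \<noteq> {}) \<and>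
         (real_linear_characters G \<noteq> {}
            \<longleftrightarrow> real_irr_characters G \<noteq> {} \<and> min_real_degree G = 1) \<and>
         (real_linear_characters G \<noteq> {} \<longleftrightarrow> carrier G \<noteq> squares_subgroup G) \<and>
         (carrier G \<noteq> squares_subgroup G
            \<longleftrightarrow> even (Coset.order (G Mod derived G (carrier G))))"
proof -
  interpret group G by (rule assms(1))
  show ?thesis
    \<comment> \<open>Condition c) is the hub: a), b) and d) are each compared with it, and the
      first conjunct combines two of these comparisons.\<close>
    using sqrt_walk_converges_iff[OF assms(2)] exists_real_linear_character_iff[OF assms(2)]
      exists_real_linear_character_iff_min_degree odd_abelianization_imp_squares_generate
      even_abelianization_imp_squares_not_generate[OF assms(2)]
    by blast
qed

end
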